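(* Let $a>b>0$ with $a/b>\alpha_4:=\sqrt{2\sqrt{2}-1}$, let $\delta=\sqrt{a^4-a^2b^2+b^4}$ and $c=\sqrt{a^2-b^2}$. Then a 3-periodic of the elliptic billiard $x^2/a^2+y^2/b^2=1$ is a right triangle when one of its vertices is at one of the four symmetric points $P^\perp_i$, $i=1,2,3,4$, given by $(\pm x^\perp,\pm y^\perp)$ with $$x^\perp=\frac{a^2\sqrt{a^4+3b^4-4b^2\delta}}{c^3},\qquad y^\perp=\frac{b^2\sqrt{-b^4-3a^4+4a^2\delta}}{c^3}.$$
   Context: A 3-periodic of the elliptic billiard with boundary $x^2/a^2+y^2/b^2=1$ is a triangle inscribed in this ellipse such that at each vertex the normal line to the ellipse is the internal angle bisector of the triangle. Through every point of the ellipse there is exactly one 3-periodic having that point as a vertex. *)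

theory Defs
  imports "HOL-Analysis.Analysis"
begin

text \<open>
  Points of the plane are pairs of reals; the product type carries the Euclidean
  norm and inner product.
\<close>

type_synonym point = "real \<times> real"

definition ellipse :: "real \<Rightarrow> real \<Rightarrow> point set" where
  "ellipse a b = {(x, y). x\<^sup>2 / a\<^sup>2 + y\<^sup>2 / b\<^sup>2 = 1}"

text \<open>
  The direction of the normal at \<open>P = (x, y)\<close> is half the gradient of
  \<open>x\<^sup>2 / a\<^sup>2 + y\<^sup>2 / b\<^sup>2\<close>.
\<close>

definition normal_line :: "real \<Rightarrow> real \<Rightarrow> point \<Rightarrow> point set" where
  "normal_line a b P = {P + t *\<^sub>R (fst P / a\<^sup>2, snd P / b\<^sup>2) | t. True}"

text \<open>The unoriented angle \<open>XAY\<close> at the middle point \<open>A\<close>, in the range from 0 to \<open>pi\<close>.\<close>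

definition vertex_angle :: "point \<Rightarrow> point \<Rightarrow> point \<Rightarrow> real" where
  "vertex_angle X A Y = arccos ((X - A) \<bullet> (Y - A) / (norm (X - A) * norm (Y - A)))"

text \<open>
  \<open>L\<close> is the internal bisector, at the vertex \<open>A\<close>, of the triangle \<open>ABC\<close>: it passes through
  \<open>A\<close> and through a point \<open>D\<close> strictly inside the opposite side, and splits the angle at
  \<open>A\<close> into two equal angles. Requiring \<open>D\<close> to lie inside the side excludes the external bisector.
\<close>

definition internal_bisector :: "point \<Rightarrow> point \<Rightarrow> point \<Rightarrow> point set \<Rightarrow> bool" where
  "internal_bisector A B C L \<longleftrightarrow>
     (\<exists>D \<in> open_segment B C. vertex_angle B A D = vertex_angle D A C \<and> L = affine hull {A, D})"

definition triangle :: "point \<Rightarrow> point \<Rightarrow> point \<Rightarrow> bool" where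
  "triangle A B C \<longleftrightarrow> \<not> collinear {A, B, C}"

definition right_triangle :: "point \<Rightarrow> point \<Rightarrow> point \<Rightarrow> bool" where
  "right_triangle A B C \<longleftrightarrow> triangle A B C \<and>
     (vertex_angle B A C = pi / 2 \<or> vertex_angle C B A = pi / 2 \<or> vertex_angle A C B = pi / 2)"

definition three_periodic :: "real \<Rightarrow> real \<Rightarrow> point \<Rightarrow> point \<Rightarrow> point \<Rightarrow> bool" where
  "three_periodic a b A B C \<longleftrightarrow>
     triangle A B C \<and> {A, B, C} \<subseteq> ellipse a b \<and>
     internal_bisector A B C (normal_line a b A) \<and>
     internal_bisector B C A (normal_line a b B) \<and>
     internal_bisector C A B (normal_line a b C)"

end

theory Submission
  imports Defs
begin

text \<open>
  A billiard trajectory in an ellipse has a constant of motion, due to Joachimsthal: the inner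
  product of its unit direction with the gradient normal \<open>n\<close> at the bounce points keeps its
  absolute value \<open>j\<close>. Along a chord this value is the same at both ends because the quadratic form
  of the ellipse is symmetric (\<open>joachimsthal_commute\<close>); at a vertex the bisector condition says
  that both sides make the same angle with the normal
  (\<open>joachimsthal_eq_if_internal_bisector\<close>). Hence all sides of a 3-periodic share one \<open>j\<close>.

  This \<open>j\<close> depends on \<open>a\<close> and \<open>b\<close> only (\<open>joachimsthal_three_periodic\<close>). In the coordinates in
  which the ellipse is the unit circle, a chord with constant \<open>j\<close> joins two points that are
  conjugate with respect to a fixed conic \<open>p * x\<^sup>2 + q * y\<^sup>2 = r\<close>, whose coefficients involve \<open>j\<^sup>2\<close>
  (\<open>conjugate_if_chord\<close>). The three vertices are thus pairwise conjugate points of the circle.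
  Eliminating two of them leaves an equation for the third with two factors; one of them would make
  the vertex lie on its own polar line, which a sign argument excludes, and the other is the condition \<open>2 * r + p * q = 0\<close> on \<open>j\<close>,
  a quadratic equation for \<open>j\<^sup>2\<close> with positive root \<open>(2 * \<delta> - a\<^sup>2 - b\<^sup>2) / (a\<^sup>2 - b\<^sup>2)\<^sup>2\<close>.

  At a vertex the half angle has cosine \<open>j / norm n\<close>, so the angle is right as soon as
  \<open>n \<bullet> n = 2 * j\<^sup>2\<close> (\<open>right_angle_if_normal\<close>). The four special points are the solutions of this
  equation on the ellipse, and the right angle sits at the special point itself.
\<close>

section \<open>Joachimsthal's constant of a chord\<close>

definition ellipse_normal :: "real \<Rightarrow> real \<Rightarrow> point \<Rightarrow> point" where
  "ellipse_normal a b P = (fst P / a\<^sup>2, snd P / b\<^sup>2)"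

text \<open>
  On the ellipse, \<open>1\<close> is the value of \<open>ellipse_normal a b P \<bullet> P\<close>, so this is the inner product of the
  normal at \<open>P\<close> with the unit vector from \<open>R\<close> to \<open>P\<close>, written in a form symmetric in \<open>P\<close> and \<open>R\<close>.
\<close>

definition joachimsthal :: "real \<Rightarrow> real \<Rightarrow> point \<Rightarrow> point \<Rightarrow> real" where
  "joachimsthal a b P R = (1 - ellipse_normal a b P \<bullet> R) / norm (R - P)"

lemma joachimsthal_commute: "joachimsthal a b P R = joachimsthal a b R P"
proof -
  have "ellipse_normal a b P \<bullet> R = ellipse_normal a b R \<bullet> P"
    by (cases P; cases R) (simp add: ellipse_normal_def mult.commute)
  then show ?thesis
    by (simp add: joachimsthal_def norm_minus_commute)
qed

lemma ellipse_normal_inner_self: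
  assumes "P \<in> ellipse a b"
  shows "ellipse_normal a b P \<bullet> P = 1"
  using assms by (cases P) (simp add: ellipse_def ellipse_normal_def power2_eq_square)

lemma joachimsthal_eq_inner:
  assumes "P \<in> ellipse a b"
  shows "(R - P) \<bullet> ellipse_normal a b P / norm (R - P) = - joachimsthal a b P R"
  using ellipse_normal_inner_self[OF assms]
  by (simp add: joachimsthal_def inner_diff_left inner_commute minus_divide_left)

text \<open>The ellipse is the unit circle in these coordinates.\<close>

lemma scaled_coordinates:
  assumes "P \<in> ellipse a b"
  shows "(fst P / a)\<^sup>2 + (snd P / b)\<^sup>2 = 1"
  using assms by (cases P) (simp add: ellipse_def power_divide)

lemma ellipse_normal_inner_scaled:
  "ellipse_normal a b P \<bullet> R = (fst P / a) * (fst R / a) + (snd P / b) * (snd R / b)"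
  by (cases P; cases R) (simp add: ellipse_normal_def power2_eq_square)

text \<open>Strict convexity: the ellipse lies on one side of each tangent line, touching it only once.\<close>

lemma ellipse_normal_inner_less_1:
  assumes "P \<in> ellipse a b" "R \<in> ellipse a b" "P \<noteq> R" "a > 0" "b > 0"
  shows "ellipse_normal a b P \<bullet> R < 1"
proof -
  define x y x' y' where "x = fst P / a" "y = snd P / b" "x' = fst R / a" "y' = snd R / b"
  note d = this
  have "x \<noteq> x' \<or> y \<noteq> y'"
    using assms(3-5) by (auto simp: d prod_eq_iff)
  then have "(x - x')\<^sup>2 + (y - y')\<^sup>2 > 0"
    by (simp add: sum_power2_gt_zero_iff)
  moreover have "(x - x')\<^sup>2 + (y - y')\<^sup>2 = 2 - 2 * (x * x' + y * y')"
    using scaled_coordinates[OF assms(1)] scaled_coordinates[OF assms(2)]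
    unfolding d[symmetric] by (simp add: power2_eq_square algebra_simps)
  ultimately show ?thesis
    unfolding ellipse_normal_inner_scaled d[symmetric] by simp
qed

lemma joachimsthal_pos:
  assumes "P \<in> ellipse a b" "R \<in> ellipse a b" "P \<noteq> R" "a > 0" "b > 0"
  shows "joachimsthal a b P R > 0"
  using ellipse_normal_inner_less_1[OF assms] assms(3) by (simp add: joachimsthal_def)

text \<open>
  The point \<open>D\<close> on the bisector gives \<open>D - A\<close> the same inner product with both unit side vectors, because
  \<open>arccos\<close> is injective on cosines. The normal is a multiple of \<open>D - A\<close>, of whatever sign, and
  inherits this.
\<close>

lemma inner_normal_eq_if_internal_bisector:
  assumes "triangle A B C" "internal_bisector A B C (normal_line a b A)"
  shows "(B - A) \<bullet> ellipse_normal a b A / norm (B - A) = (C - A) \<bullet> ellipse_normal a b A / norm (C - A)"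
proof -
  obtain D where D: "D \<in> open_segment B C" "vertex_angle B A D = vertex_angle D A C"
    "normal_line a b A = affine hull {A, D}"
    using assms(2) by (auto simp: internal_bisector_def)
  have nc: "\<not> collinear {A, B, C}"
    using assms(1) by (simp add: triangle_def)
  have "A \<noteq> D"
  proof
    assume "A = D"
    then have "between (B, C) A"
      using D(1) by (simp add: between_mem_segment open_segment_def)
    then have "collinear {B, A, C}"
      by (rule between_imp_collinear)
    then show False
      using nc by (simp add: insert_commute)
  qed
  let ?n = "ellipse_normal a b A"
  have "A + 1 *\<^sub>R ?n \<in> affine hull {A, D}"
    unfolding D(3)[symmetric] normal_line_def ellipse_normal_def by blast
  then have "\<exists>t. ?n = t *\<^sub>R (D - A)"
    unfolding affine_hull_2_alt by auto
  then obtain t where t: "?n = t *\<^sub>R (D - A)" ..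
  have cos_le_1: "\<bar>(X - A) \<bullet> (Y - A) / (norm (X - A) * norm (Y - A))\<bar> \<le> 1" for X Y :: point
    using Cauchy_Schwarz_ineq2[of "X - A" "Y - A"] by (auto simp: divide_le_eq_1 abs_mult)
  have "(B - A) \<bullet> (D - A) / (norm (B - A) * norm (D - A)) = (D - A) \<bullet> (C - A) / (norm (D - A) * norm (C - A))"
    using D(2) cos_le_1 arccos_eq_iff[of "(B - A) \<bullet> (D - A) / (norm (B - A) * norm (D - A))"
        "(D - A) \<bullet> (C - A) / (norm (D - A) * norm (C - A))"]
    unfolding vertex_angle_def by blast
  then have "(B - A) \<bullet> (D - A) / norm (B - A) / norm (D - A) = (C - A) \<bullet> (D - A) / norm (C - A) / norm (D - A)"
    by (simp add: inner_commute mult.commute)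
  then have "(B - A) \<bullet> (D - A) / norm (B - A) = (C - A) \<bullet> (D - A) / norm (C - A)"
    using \<open>A \<noteq> D\<close> by (metis divide_cancel_right norm_eq_zero right_minus_eq)
  then show ?thesis
    unfolding t by (metis inner_scaleR_right times_divide_eq_right)
qed

lemma joachimsthal_eq_if_internal_bisector:
  assumes "triangle A B C" "A \<in> ellipse a b" "internal_bisector A B C (normal_line a b A)"
  shows "joachimsthal a b A B = joachimsthal a b A C"
  using inner_normal_eq_if_internal_bisector[OF assms(1,3)] joachimsthal_eq_inner[OF assms(2)] by simp

section \<open>Chords as conjugate pairs on the unit circle\<close>

text \<open>
  With \<open>s = x * x' + y * y'\<close>, the identity
  \<open>(1 - s) * (1 - x * x' + y * y') = (x - x')\<^sup>2\<close> on the circle and its analogue for \<open>y\<close> make the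
  hypothesis, which is quadratic in \<open>1 - s\<close>, divisible by \<open>1 - s\<close>. In terms of angles this is the
  product formula for the difference of two cosines.
\<close>

lemma circle_chord_conjugate:
  fixes x y x' y' g a b :: real
  assumes "x\<^sup>2 + y\<^sup>2 = 1" "x'\<^sup>2 + y'\<^sup>2 = 1" "x * x' + y * y' \<noteq> 1"
    "(1 - (x * x' + y * y'))\<^sup>2 = g * (a\<^sup>2 * (x - x')\<^sup>2 + b\<^sup>2 * (y - y')\<^sup>2)"
  shows "(1 - g * (a\<^sup>2 - b\<^sup>2)) * (x * x') + (1 + g * (a\<^sup>2 - b\<^sup>2)) * (y * y') = 1 - g * (a\<^sup>2 + b\<^sup>2)"
proof -
  have "(1 - (x * x' + y * y')) *
    ((1 - g * (a\<^sup>2 - b\<^sup>2)) * (x * x') + (1 + g * (a\<^sup>2 - b\<^sup>2)) * (y * y') - (1 - g * (a\<^sup>2 + b\<^sup>2))) = 0"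
    using assms(1,2,4) by algebra
  then show ?thesis
    using assms(3) by auto
qed

lemma conjugate_if_chord:
  fixes a b j :: real
  assumes "P \<in> ellipse a b" "R \<in> ellipse a b" "P \<noteq> R" "a > 0" "b > 0" "joachimsthal a b P R = j"
  shows "(1 - j\<^sup>2 * (a\<^sup>2 - b\<^sup>2)) * ((fst P / a) * (fst R / a)) +
    (1 + j\<^sup>2 * (a\<^sup>2 - b\<^sup>2)) * ((snd P / b) * (snd R / b)) = 1 - j\<^sup>2 * (a\<^sup>2 + b\<^sup>2)"
proof (rule circle_chord_conjugate)
  let ?s = "(fst P / a) * (fst R / a) + (snd P / b) * (snd R / b)"
  show "(fst P / a)\<^sup>2 + (snd P / b)\<^sup>2 = 1" "(fst R / a)\<^sup>2 + (snd R / b)\<^sup>2 = 1"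
    using scaled_coordinates assms(1,2) by blast+
  show "?s \<noteq> 1"
    using ellipse_normal_inner_less_1[OF assms(1-5)] unfolding ellipse_normal_inner_scaled by simp
  have "1 - ?s = j * norm (R - P)"
    using assms(3,6) unfolding joachimsthal_def ellipse_normal_inner_scaled by (auto simp: divide_eq_eq)
  then have "(1 - ?s)\<^sup>2 = j\<^sup>2 * (norm (R - P))\<^sup>2"
    by (simp only: power_mult_distrib)
  also have "(norm (R - P))\<^sup>2 = (fst R - fst P)\<^sup>2 + (snd R - snd P)\<^sup>2"
    by (cases P; cases R) (simp add: norm_Pair)
  also have "\<dots> = a\<^sup>2 * (fst P / a - fst R / a)\<^sup>2 + b\<^sup>2 * (snd P / b - snd R / b)\<^sup>2"
    using assms(4,5) by (simp add: power_divide power2_commute flip: diff_divide_distrib)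
  finally show "(1 - ?s)\<^sup>2 = j\<^sup>2 * (a\<^sup>2 * (fst P / a - fst R / a)\<^sup>2 + b\<^sup>2 * (snd P / b - snd R / b)\<^sup>2)" .
qed

section \<open>The constant of a 3-periodic\<close>

text \<open>
  Eliminating the ordinate from the equations of a line and of the unit circle gives a quadratic
  equation for the abscissas of the common points; this is Vieta's formula for its constant term.
\<close>

lemma line_circle_product:
  fixes m n r x y x' y' :: real
  assumes "m * x + n * y = r" "m * x' + n * y' = r"
    and "x\<^sup>2 + y\<^sup>2 = 1" "x'\<^sup>2 + y'\<^sup>2 = 1" and "(x, y) \<noteq> (x', y')"
  shows "(m\<^sup>2 + n\<^sup>2) * (x * x') = r\<^sup>2 - n\<^sup>2"
proof (cases "x = x'")
  case True
  \<comment> \<open>The line is vertical and its abscissa is a double root.\<close>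
  have "n * y = n * y'"
    using assms(1,2) unfolding True by linarith
  then have "n = 0"
    using True assms(5) by auto
  then show ?thesis
    using True assms(1) by (simp add: power2_eq_square algebra_simps)
next
  case False
  have quadratic: "(m\<^sup>2 + n\<^sup>2) * u\<^sup>2 - 2 * r * m * u + r\<^sup>2 - n\<^sup>2 = 0"
    if "m * u + n * v = r" "u\<^sup>2 + v\<^sup>2 = 1" for u v
  proof -
    have "n * v = r - m * u" "v\<^sup>2 = 1 - u\<^sup>2"
      using that by simp_all
    then have "n\<^sup>2 * (1 - u\<^sup>2) = (r - m * u)\<^sup>2"
      by (metis power_mult_distrib)
    then show ?thesis
      by (simp add: power2_eq_square algebra_simps)
  qed
  have "(x - x') * ((m\<^sup>2 + n\<^sup>2) * (x * x') - (r\<^sup>2 - n\<^sup>2)) = 0"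
    using quadratic[OF assms(1,3)] quadratic[OF assms(2,4)] by algebra
  then show ?thesis
    using False by simp
qed

text \<open>
  Both \<open>(x2, y2)\<close> and \<open>(x3, y3)\<close> lie on the polar line \<open>p * x1 * x + q * y1 * y = r\<close> of the first
  vertex, so Vieta's formula expresses \<open>x2 * x3\<close> and \<open>y2 * y3\<close> through that vertex; conjugacy of the
  last pair then becomes the stated equation. Its second factor vanishes precisely if the first
  vertex lies on its own polar line.
\<close>

lemma conjugate_triple_on_circle:
  fixes p q r x1 y1 x2 y2 x3 y3 :: real
  assumes "x1\<^sup>2 + y1\<^sup>2 = 1" "x2\<^sup>2 + y2\<^sup>2 = 1" "x3\<^sup>2 + y3\<^sup>2 = 1" "(x2, y2) \<noteq> (x3, y3)"
    and "p * (x1 * x2) + q * (y1 * y2) = r" "p * (x1 * x3) + q * (y1 * y3) = r"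
    and "p * (x2 * x3) + q * (y2 * y3) = r" "p + q = 2"
  shows "(2 * r + p * q) * (p * x1\<^sup>2 + q * y1\<^sup>2 - r) = 0"
proof -
  have "((p * x1)\<^sup>2 + (q * y1)\<^sup>2) * (x2 * x3) = r\<^sup>2 - (q * y1)\<^sup>2"
    by (rule line_circle_product[where y = y2 and y' = y3]) (use assms in \<open>simp_all add: mult.assoc\<close>)
  moreover have "((q * y1)\<^sup>2 + (p * x1)\<^sup>2) * (y2 * y3) = r\<^sup>2 - (p * x1)\<^sup>2"
    by (rule line_circle_product[where y = x2 and y' = x3]) (use assms in \<open>auto simp: algebra_simps\<close>)
  ultimately show ?thesis
    using assms(1,7,8) by algebra
qed

lemma joachimsthal_three_periodic:
  fixes a b :: real
  assumes "a > b" "b > 0" "three_periodic a b A B C"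
  shows "(a\<^sup>2 - b\<^sup>2)\<^sup>2 * (joachimsthal a b A B)\<^sup>2 = 2 * sqrt (a^4 - a\<^sup>2 * b\<^sup>2 + b^4) - a\<^sup>2 - b\<^sup>2"
proof -
  define j where "j = joachimsthal a b A B"
  have tri: "triangle A B C" "triangle B C A" and el: "A \<in> ellipse a b" "B \<in> ellipse a b" "C \<in> ellipse a b"
    using assms(3) by (auto simp: three_periodic_def triangle_def insert_commute)
  have jAC: "joachimsthal a b A C = j"
    using joachimsthal_eq_if_internal_bisector[of A B C a b] tri el assms(3)
    by (simp add: three_periodic_def j_def)
  have jBC: "joachimsthal a b B C = j"
    using joachimsthal_eq_if_internal_bisector[of B C A a b] tri el assms(3)
    by (simp add: three_periodic_def j_def joachimsthal_commute[of a b A])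
  have neq: "A \<noteq> B" "A \<noteq> C" "B \<noteq> C"
    using tri(1) by (auto simp: triangle_def insert_commute)
  have pos: "a > 0" "b > 0"
    using assms(1,2) by auto
  have jpos: "j > 0"
    using joachimsthal_pos[OF el(1,2) neq(1) pos] by (simp add: j_def)
  have ab: "a\<^sup>2 > b\<^sup>2"
    using assms(1,2) by (simp add: power_strict_mono)
  define p q r where "p = 1 - j\<^sup>2 * (a\<^sup>2 - b\<^sup>2)" "q = 1 + j\<^sup>2 * (a\<^sup>2 - b\<^sup>2)" "r = 1 - j\<^sup>2 * (a\<^sup>2 + b\<^sup>2)"
  note pqr = this
  have "(2 * r + p * q) * (p * (fst A / a)\<^sup>2 + q * (snd A / b)\<^sup>2 - r) = 0"
  proof (rule conjugate_triple_on_circle)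
    show "(fst B / a, snd B / b) \<noteq> (fst C / a, snd C / b)"
      using neq(3) pos by (auto simp: prod_eq_iff)
    show "p + q = 2"
      by (simp add: pqr)
    show "p * (fst A / a * (fst B / a)) + q * (snd A / b * (snd B / b)) = r"
      unfolding pqr by (rule conjugate_if_chord[OF el(1,2) neq(1) pos j_def[symmetric]])
    show "p * (fst A / a * (fst C / a)) + q * (snd A / b * (snd C / b)) = r"
      unfolding pqr by (rule conjugate_if_chord[OF el(1,3) neq(2) pos jAC])
    show "p * (fst B / a * (fst C / a)) + q * (snd B / b * (snd C / b)) = r"
      unfolding pqr by (rule conjugate_if_chord[OF el(2,3) neq(3) pos jBC])
  qed (use scaled_coordinates el in blast)+
  moreover have "p * (fst A / a)\<^sup>2 + q * (snd A / b)\<^sup>2 > r"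
  proof -
    define x y where "x = (fst A / a)\<^sup>2" "y = (snd A / b)\<^sup>2"
    note d = this
    \<comment> \<open>The difference of the two sides is a multiple of \<open>j\<^sup>2\<close>, with a positive factor.\<close>
    have xy: "x + y = 1" "y \<ge> 0"
      using scaled_coordinates[OF el(1)] by (simp_all add: d)
    have "p * x + q * y - r = j\<^sup>2 * (2 * b\<^sup>2 + 2 * ((a\<^sup>2 - b\<^sup>2) * y))"
      using xy(1) unfolding pqr by algebra
    also have "\<dots> > 0"
    proof -
      have "(a\<^sup>2 - b\<^sup>2) * y \<ge> 0"
        using ab xy(2) by simp
      then have "2 * b\<^sup>2 + 2 * ((a\<^sup>2 - b\<^sup>2) * y) > 0"
        using pos by (intro add_pos_nonneg) simp_all
      then show ?thesis
        by (rule mult_pos_pos[OF zero_less_power[OF jpos]])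
    qed
    finally show ?thesis
      by (simp add: d)
  qed
  ultimately have "2 * r + p * q = 0"
    by simp
  \<comment> \<open>This quadratic equation for \<open>j\<^sup>2\<close>, multiplied by \<open>(a\<^sup>2 - b\<^sup>2)\<^sup>2\<close> and with the square completed.\<close>
  then have "((a\<^sup>2 - b\<^sup>2)\<^sup>2 * j\<^sup>2 + a\<^sup>2 + b\<^sup>2)\<^sup>2 = 4 * (a^4 - a\<^sup>2 * b\<^sup>2 + b^4)"
    unfolding pqr by algebra
  then have "sqrt (4 * (a^4 - a\<^sup>2 * b\<^sup>2 + b^4)) = (a\<^sup>2 - b\<^sup>2)\<^sup>2 * j\<^sup>2 + a\<^sup>2 + b\<^sup>2"
    by (intro real_sqrt_unique) (auto intro!: add_nonneg_nonneg)
  then show ?thesis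
    unfolding real_sqrt_mult j_def by simp
qed

section \<open>Right angles\<close>

text \<open>In the plane, two vectors orthogonal to a common nonzero vector are parallel.\<close>

lemma inner_square_if_common_orthogonal:
  fixes e m w :: "real \<times> real"
  assumes "e \<noteq> 0" "e \<bullet> m = 0" "e \<bullet> w = 0"
  shows "(m \<bullet> m) * (w \<bullet> w) = (m \<bullet> w)\<^sup>2"
proof -
  obtain e1 e2 m1 m2 w1 w2 where [simp]: "e = (e1, e2)" "m = (m1, m2)" "w = (w1, w2)"
    by (metis surj_pair)
  have "e1 * (m1 * w2 - m2 * w1) = 0" "e2 * (m1 * w2 - m2 * w1) = 0"
    using assms(2,3) by (simp_all, algebra+)
  then have "m1 * w2 - m2 * w1 = 0"
    using assms(1) by (auto simp: zero_prod_def)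
  then show ?thesis
    by (simp, algebra)
qed

text \<open>
  The difference of the unit side vectors \<open>u\<close>, \<open>v\<close> is orthogonal to both \<open>n\<close> and \<open>u + v\<close>, so
  \<open>(n \<bullet> n) * (2 + 2 * (u \<bullet> v)) = (2 * j)\<^sup>2\<close>, which is the double angle formula for the vertex angle.
\<close>

lemma right_angle_if_normal:
  assumes "triangle A B C" "A \<in> ellipse a b" "joachimsthal a b A B = j" "joachimsthal a b A C = j"
    and "j \<noteq> 0" "ellipse_normal a b A \<bullet> ellipse_normal a b A = 2 * j\<^sup>2"
  shows "vertex_angle B A C = pi / 2"
proof -
  let ?n = "ellipse_normal a b A"
  define u v where "u = (B - A) /\<^sub>R norm (B - A)" "v = (C - A) /\<^sub>R norm (C - A)"
  note d = this
  have nc: "\<not> collinear {A, B, C}"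
    using assms(1) by (simp add: triangle_def)
  then have neq: "B \<noteq> A" "C \<noteq> A"
    by (auto simp: insert_commute)
  have unit: "u \<bullet> u = 1" "v \<bullet> v = 1"
    using neq by (simp_all add: d dot_square_norm power2_eq_square)
  have "u \<noteq> v"
  proof
    assume "u = v"
    then have "norm (B - A) *\<^sub>R u = norm (B - A) *\<^sub>R v"
      by simp
    then have "B - A = (norm (B - A) / norm (C - A)) *\<^sub>R (C - A)"
      using neq by (simp add: d divide_inverse)
    then have "collinear {0, C - A, B - A}"
      unfolding collinear_lemma by blast
    then have "collinear {C, A, B}"
      by (subst collinear_3) (simp add: insert_commute)
    then show False
      using nc by (simp add: insert_commute)
  qed
  have n: "u \<bullet> ?n = - j" "v \<bullet> ?n = - j"
    using joachimsthal_eq_inner[OF assms(2), of B] joachimsthal_eq_inner[OF assms(2), of C] assms(3,4)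
    by (simp_all add: d divide_inverse mult.commute)
  have "(?n \<bullet> ?n) * ((u + v) \<bullet> (u + v)) = (?n \<bullet> (u + v))\<^sup>2"
    by (rule inner_square_if_common_orthogonal[of "u - v"])
      (use \<open>u \<noteq> v\<close> unit n in \<open>simp_all add: inner_diff_left inner_diff_right inner_add_left inner_add_right inner_commute\<close>)
  also have "?n \<bullet> (u + v) = - (2 * j)"
    using n by (simp add: inner_add_left inner_commute)
  also have "(u + v) \<bullet> (u + v) = 2 + 2 * (u \<bullet> v)"
    using unit by (simp add: inner_add_left inner_add_right inner_commute)
  finally have "j\<^sup>2 * (u \<bullet> v) = 0"
    unfolding assms(6) by (simp add: power_mult_distrib algebra_simps)
  then have "u \<bullet> v = 0"
    using assms(5) by simp
  then have "(B - A) \<bullet> (C - A) = 0"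
    using neq by (simp add: d)
  then show ?thesis
    by (simp add: vertex_angle_def)
qed

lemma three_periodic_right_angle:
  fixes a b :: real
  assumes "a > b" "b > 0" "three_periodic a b A B C"
    and "(a\<^sup>2 - b\<^sup>2)\<^sup>2 * (ellipse_normal a b A \<bullet> ellipse_normal a b A) =
      2 * (2 * sqrt (a^4 - a\<^sup>2 * b\<^sup>2 + b^4) - a\<^sup>2 - b\<^sup>2)"
  shows "vertex_angle B A C = pi / 2"
proof (rule right_angle_if_normal)
  show tri: "triangle A B C" and A: "A \<in> ellipse a b"
    using assms(3) by (auto simp: three_periodic_def)
  show "joachimsthal a b A C = joachimsthal a b A B"
    using joachimsthal_eq_if_internal_bisector[OF tri A] assms(3) by (simp add: three_periodic_def)
  have "B \<in> ellipse a b" "A \<noteq> B"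
    using assms(3) by (auto simp: three_periodic_def triangle_def)
  then show "joachimsthal a b A B \<noteq> 0"
    using joachimsthal_pos[OF A] assms(1,2) by fastforce
  have "a\<^sup>2 \<noteq> b\<^sup>2"
    using assms(1,2) by (simp add: power2_eq_iff)
  moreover have "(a\<^sup>2 - b\<^sup>2)\<^sup>2 * (ellipse_normal a b A \<bullet> ellipse_normal a b A) =
      (a\<^sup>2 - b\<^sup>2)\<^sup>2 * (2 * (joachimsthal a b A B)\<^sup>2)"
    using assms(4) joachimsthal_three_periodic[OF assms(1-3)] by simp
  ultimately show "ellipse_normal a b A \<bullet> ellipse_normal a b A = 2 * (joachimsthal a b A B)\<^sup>2"
    by simp
qed simp

section \<open>The special points\<close>

text \<open>
  Compare squares: their difference is \<open>(a\<^sup>2 - b\<^sup>2)\<^sup>2 * ((a\<^sup>2 + b\<^sup>2)\<^sup>2 - 8 * b^4)\<close>. Its sign is where the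
  threshold \<open>sqrt (2 * sqrt 2 - 1)\<close> for \<open>a / b\<close> comes from.
\<close>

lemma abscissa_radicand_pos:
  fixes a b :: real
  assumes "a > b" "b > 0" "a / b > sqrt (2 * sqrt 2 - 1)"
  shows "a^4 + 3 * b^4 - 4 * b\<^sup>2 * sqrt (a^4 - a\<^sup>2 * b\<^sup>2 + b^4) > 0"
proof -
  have "sqrt 2 \<ge> 1"
    by simp
  then have s2: "2 * sqrt 2 - 1 \<ge> 0"
    by linarith
  have ab: "a\<^sup>2 > b\<^sup>2"
    using assms(1,2) by (simp add: power_strict_mono)
  have "(sqrt (2 * sqrt 2 - 1))\<^sup>2 < (a / b)\<^sup>2"
    using assms(3) s2 by (intro power_strict_mono) auto
  then have "2 * sqrt 2 - 1 < a\<^sup>2 / b\<^sup>2"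
    using s2 by (simp add: power_divide)
  then have "2 * sqrt 2 * b\<^sup>2 < a\<^sup>2 + b\<^sup>2"
    using assms(2) by (simp add: less_divide_eq algebra_simps)
  then have "(2 * sqrt 2 * b\<^sup>2)\<^sup>2 < (a\<^sup>2 + b\<^sup>2)\<^sup>2"
    by (intro power_strict_mono) auto
  then have "0 < (a\<^sup>2 - b\<^sup>2)\<^sup>2 * ((a\<^sup>2 + b\<^sup>2)\<^sup>2 - 8 * b^4)"
    using ab by (intro mult_pos_pos) (simp_all add: power_mult_distrib flip: power_mult)
  also have "\<dots> = (a^4 + 3 * b^4)\<^sup>2 - 16 * b^4 * (a^4 - a\<^sup>2 * b\<^sup>2 + b^4)"
    by algebra
  finally have "16 * b^4 * (a^4 - a\<^sup>2 * b\<^sup>2 + b^4) < (a^4 + 3 * b^4)\<^sup>2"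
    by simp
  then have "sqrt (16 * b^4 * (a^4 - a\<^sup>2 * b\<^sup>2 + b^4)) < a^4 + 3 * b^4"
    by (intro real_less_lsqrt) auto
  moreover have "sqrt (16 * b^4 * (a^4 - a\<^sup>2 * b\<^sup>2 + b^4)) = 4 * b\<^sup>2 * sqrt (a^4 - a\<^sup>2 * b\<^sup>2 + b^4)"
  proof -
    have "sqrt (16 * b^4) = 4 * b\<^sup>2"
      by (rule real_sqrt_unique) (simp_all add: power4_eq_xxxx power2_eq_square)
    then show ?thesis
      by (simp only: real_sqrt_mult[of "16 * b^4"])
  qed
  ultimately show ?thesis
    by simp
qed

text \<open>
  Here the difference of squares is \<open>(a\<^sup>2 - b\<^sup>2)\<^sup>2 * (7 * a^4 - 2 * a\<^sup>2 * b\<^sup>2 - b^4)\<close>.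
\<close>

lemma ordinate_radicand_pos:
  fixes a b :: real
  assumes "a > b" "b > 0"
  shows "- (b^4) - 3 * a^4 + 4 * a\<^sup>2 * sqrt (a^4 - a\<^sup>2 * b\<^sup>2 + b^4) > 0"
proof -
  have ab: "a\<^sup>2 > b\<^sup>2"
    using assms by (simp add: power_strict_mono)
  have "a\<^sup>2 * b\<^sup>2 \<le> a\<^sup>2 * a\<^sup>2" "b\<^sup>2 * b\<^sup>2 \<le> a\<^sup>2 * a\<^sup>2"
    using ab by (intro mult_mono; simp)+
  moreover have "a\<^sup>2 * a\<^sup>2 > 0"
    using assms by simp
  ultimately have "7 * a^4 - 2 * a\<^sup>2 * b\<^sup>2 - b^4 > 0"
    by (simp add: power4_eq_xxxx power2_eq_square algebra_simps)
  then have "0 < (a\<^sup>2 - b\<^sup>2)\<^sup>2 * (7 * a^4 - 2 * a\<^sup>2 * b\<^sup>2 - b^4)"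
    using ab by (intro mult_pos_pos) auto
  also have "\<dots> = 16 * a^4 * (a^4 - a\<^sup>2 * b\<^sup>2 + b^4) - (b^4 + 3 * a^4)\<^sup>2"
    by algebra
  finally have "(b^4 + 3 * a^4)\<^sup>2 < 16 * a^4 * (a^4 - a\<^sup>2 * b\<^sup>2 + b^4)"
    by simp
  then have "b^4 + 3 * a^4 < sqrt (16 * a^4 * (a^4 - a\<^sup>2 * b\<^sup>2 + b^4))"
    by (rule real_less_rsqrt)
  moreover have "sqrt (16 * a^4 * (a^4 - a\<^sup>2 * b\<^sup>2 + b^4)) = 4 * a\<^sup>2 * sqrt (a^4 - a\<^sup>2 * b\<^sup>2 + b^4)"
  proof -
    have "sqrt (16 * a^4) = 4 * a\<^sup>2"
      by (rule real_sqrt_unique) (simp_all add: power4_eq_xxxx power2_eq_square)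
    then show ?thesis
      by (simp only: real_sqrt_mult[of "16 * a^4"])
  qed
  ultimately show ?thesis
    by simp
qed

theorem proposition5:
  fixes a b \<alpha>\<^sub>4 \<delta> c x\<^sub>p y\<^sub>p :: real and Ps :: "point set"
  assumes "a > b" and "b > 0"
    and "\<alpha>\<^sub>4 = sqrt (2 * sqrt 2 - 1)" and "a / b > \<alpha>\<^sub>4"
    and "\<delta> = sqrt (a^4 - a^2 * b^2 + b^4)"
    and "c = sqrt (a^2 - b^2)"
    and "x\<^sub>p = a^2 * sqrt (a^4 + 3 * b^4 - 4 * b^2 * \<delta>) / c^3"
    and "y\<^sub>p = b^2 * sqrt (- (b^4) - 3 * a^4 + 4 * a^2 * \<delta>) / c^3"
    and "Ps = {(x\<^sub>p, y\<^sub>p), (- x\<^sub>p, y\<^sub>p), (x\<^sub>p, - y\<^sub>p), (- x\<^sub>p, - y\<^sub>p)}"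
  shows "a^4 + 3 * b^4 - 4 * b^2 * \<delta> > 0 \<and> - (b^4) - 3 * a^4 + 4 * a^2 * \<delta> > 0 \<and>
    Ps \<subseteq> ellipse a b \<and>
    (\<forall>A B C. three_periodic a b A B C \<and> {A, B, C} \<inter> Ps \<noteq> {} \<longrightarrow> right_triangle A B C)"
proof -
  let ?X = "a^4 + 3 * b^4 - 4 * b\<^sup>2 * \<delta>" and ?Y = "- (b^4) - 3 * a^4 + 4 * a\<^sup>2 * \<delta>"
  have X: "?X > 0"
    using abscissa_radicand_pos[of b a] assms(1-5) by simp
  have Y: "?Y > 0"
    using ordinate_radicand_pos[of b a] assms(1,2,5) by simp
  have pos: "a > 0" "b > 0" and ab: "a\<^sup>2 - b\<^sup>2 > 0"
    using assms(1,2) by (auto simp: power_strict_mono)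
  have c6: "(c^3)\<^sup>2 = (a\<^sup>2 - b\<^sup>2)^3"
    using ab unfolding assms(6) by (metis less_imp_le power_commutes power_mult real_sqrt_pow2 mult.commute)
  have xsq: "x\<^sub>p\<^sup>2 = a^4 * ?X / (a\<^sup>2 - b\<^sup>2)^3"
    using X unfolding assms(7) power_divide power_mult_distrib c6 by simp
  have ysq: "y\<^sub>p\<^sup>2 = b^4 * ?Y / (a\<^sup>2 - b\<^sup>2)^3"
    using Y unfolding assms(8) power_divide power_mult_distrib c6 by simp
  have sq: "(fst P)\<^sup>2 = x\<^sub>p\<^sup>2 \<and> (snd P)\<^sup>2 = y\<^sub>p\<^sup>2" if "P \<in> Ps" for P
    using that unfolding assms(9) by auto
  have on: "Ps \<subseteq> ellipse a b"
  proof
    fix P assume "P \<in> Ps"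
    have "x\<^sub>p\<^sup>2 / a\<^sup>2 + y\<^sub>p\<^sup>2 / b\<^sup>2 = (a\<^sup>2 * ?X + b\<^sup>2 * ?Y) / (a\<^sup>2 - b\<^sup>2)^3"
      unfolding xsq ysq using pos by (simp add: add_divide_distrib power4_eq_xxxx power2_eq_square)
    also have "a\<^sup>2 * ?X + b\<^sup>2 * ?Y = (a\<^sup>2 - b\<^sup>2)^3"
      by algebra
    finally show "P \<in> ellipse a b"
      using sq[OF \<open>P \<in> Ps\<close>] ab by (cases P) (simp add: ellipse_def)
  qed
  have normal: "(a\<^sup>2 - b\<^sup>2)\<^sup>2 * (ellipse_normal a b P \<bullet> ellipse_normal a b P) = 2 * (2 * \<delta> - a\<^sup>2 - b\<^sup>2)"
    if "P \<in> Ps" for P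
  proof -
    have "ellipse_normal a b P \<bullet> ellipse_normal a b P = x\<^sub>p\<^sup>2 / a^4 + y\<^sub>p\<^sup>2 / b^4"
      using sq[OF that] by (simp add: ellipse_normal_def power4_eq_xxxx power2_eq_square)
    also have "\<dots> = (?X + ?Y) / (a\<^sup>2 - b\<^sup>2)^3"
      unfolding xsq ysq add_divide_distrib[of ?X ?Y] using pos by simp
    also have "?X + ?Y = (a\<^sup>2 - b\<^sup>2) * (2 * (2 * \<delta> - a\<^sup>2 - b\<^sup>2))"
      by algebra
    also have "\<dots> / (a\<^sup>2 - b\<^sup>2)^3 = 2 * (2 * \<delta> - a\<^sup>2 - b\<^sup>2) / (a\<^sup>2 - b\<^sup>2)\<^sup>2"
      using ab by (simp add: power3_eq_cube power2_eq_square)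
    finally show ?thesis
      using ab by simp
  qed
  have right: "vertex_angle B A C = pi / 2" if "three_periodic a b A B C" "A \<in> Ps" for A B C
    using three_periodic_right_angle[OF assms(1,2) that(1)] normal[OF that(2)] assms(5) by simp
  have "right_triangle A B C" if tp: "three_periodic a b A B C" and meet: "{A, B, C} \<inter> Ps \<noteq> {}" for A B C
  proof -
    have "three_periodic a b B C A" "three_periodic a b C A B"
      using tp by (auto simp: three_periodic_def triangle_def insert_commute)
    then show ?thesis
      using right tp meet unfolding right_triangle_def three_periodic_def by blast
  qed
  then show ?thesis
    using X Y on by blast
qed

end
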